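(* Let $\kappa\neq 0$ be a real constant and let $u$ be a nontrivial solution, for some $\lambda\in(0,\infty)$, of $$-u''(x)=\lambda u(x)\,[1+\kappa (u'(x))^2]^{3/2},\quad 0<x<1,\qquad u(0)=u(1)=0.$$ Then $u\in S_n^\nu$ for some $\nu\in\{+,-\}$ and some $n\in\{1,2,\dots\}$.
   Context: $C^1_0[0,1]$ is the space of $C^1$ functions on $[0,1]$ vanishing at $0$ and $1$. For $n\in\{1,2,\dots\}$ and $\nu\in\{+,-\}$, $$S_n^\nu:=\{u\in C_0^1[0,1] : u \text{ has exactly } n-1 \text{ simple zeros in } (0,1), \text{ and } \nu u \text{ is positive near } 0\}$$ (positive near $0$ means on some interval $(0,\varepsilon)$; $\nu$ is identified with $\pm1$). A zero $\tau$ of $u$ is simple if $u'(\tau)\neq0$. Solutions are classical ($C^2$), with $1+\kappa (u')^2>0$ on $[0,1]$; nontrivial means not identically zero. *)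

theory Defs
  imports "HOL-Analysis.Analysis"
begin

text \<open>
  A function on the closed unit interval is represented by a total function of type
  \<open>real \<Rightarrow> real\<close>; only its values on \<open>{0..1}\<close> matter. Derivatives are therefore taken
  within \<open>{0..1}\<close>, hence one-sided at the two endpoints (and ordinary inside).
\<close>

definition D01 :: "(real \<Rightarrow> real) \<Rightarrow> real \<Rightarrow> real" where
  "D01 u x = vector_derivative u (at x within {0..1})"

definition C1_01 :: "(real \<Rightarrow> real) set" where
  "C1_01 = {u. u differentiable_on {0..1} \<and> continuous_on {0..1} (D01 u)}"

definition C2_01 :: "(real \<Rightarrow> real) set" where
  "C2_01 = {u. u \<in> C1_01 \<and> D01 u \<in> C1_01}"

definition C10_01 :: "(real \<Rightarrow> real) set" where
  "C10_01 = {u. u \<in> C1_01 \<and> u 0 = 0 \<and> u 1 = 0}"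

definition interior_zeros :: "(real \<Rightarrow> real) \<Rightarrow> real set" where
  "interior_zeros u = {t. 0 < t \<and> t < 1 \<and> u t = 0}"

text \<open>
  ``Exactly \<open>n - 1\<close> simple zeros in \<open>(0,1)\<close>'' is read in the usual sense: there are exactly
  \<open>n - 1\<close> zeros in \<open>(0,1)\<close> and all of them are simple. The sign \<open>\<nu>\<close> is a real number,
  meant to be \<open>1\<close> or \<open>-1\<close>.
\<close>

definition S :: "nat \<Rightarrow> real \<Rightarrow> (real \<Rightarrow> real) set" where
  "S n \<nu> = {u. u \<in> C10_01
      \<and> finite (interior_zeros u) \<and> card (interior_zeros u) + 1 = n
      \<and> (\<forall>t \<in> interior_zeros u. D01 u t \<noteq> 0)
      \<and> (\<exists>\<epsilon>. 0 < \<epsilon> \<and> \<epsilon> \<le> 1 \<and> (\<forall>x. 0 < x \<and> x < \<epsilon> \<longrightarrow> 0 < \<nu> * u x))}"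

definition is_solution :: "real \<Rightarrow> real \<Rightarrow> (real \<Rightarrow> real) \<Rightarrow> bool" where
  "is_solution \<kappa> l u \<longleftrightarrow>
     u \<in> C2_01
     \<and> (\<forall>x\<in>{0..1}. 0 < 1 + \<kappa> * (D01 u x)\<^sup>2)
     \<and> (\<forall>x. 0 < x \<and> x < 1 \<longrightarrow>
          - D01 (D01 u) x = l * u x * (1 + \<kappa> * (D01 u x)\<^sup>2) powr (3 / 2))
     \<and> u 0 = 0 \<and> u 1 = 0"

definition nontrivial :: "(real \<Rightarrow> real) \<Rightarrow> bool" where
  "nontrivial u \<longleftrightarrow> (\<exists>x\<in>{0..1}. u x \<noteq> 0)"

end

theory Submission
  imports Defs
begin

text \<open>
  Along a solution, the quantity
  \<open>(1 + \<kappa> u'\<^sup>2) powr (-1/2) - \<kappa> \<lambda> u\<^sup>2 / 2\<close> is constant (\<open>solution_energy_conserved\<close>). If \<open>u\<close> and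
  \<open>u'\<close> vanished together at some point of \<open>[0,1]\<close>, this constant would be \<open>1\<close>, that is,
  \<open>(1 + \<kappa> u'\<^sup>2) powr (-1/2) - 1 = \<kappa> \<lambda> u\<^sup>2 / 2\<close> everywhere. The left side has the sign of
  \<open>-\<kappa>\<close> (or is zero) and the right side has the sign of \<open>\<kappa>\<close> (or is zero), so both are zero and
  \<open>u\<close> vanishes identically. Hence every zero of a nontrivial solution in \<open>[0,1]\<close>, endpoints
  included, is simple (\<open>zeros_simple_if_nontrivial\<close>); this replaces the usual appeal to uniqueness
  for the initial value problem.

  Everything else is compactness: simple zeros are isolated, and a closed subset of \<open>[0,1]\<close> all of
  whose points are isolated is finite. The sign of \<open>u\<close> near \<open>0\<close> is that of \<open>u' 0 \<noteq> 0\<close>.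
\<close>

lemma C1_01_has_derivative:
  assumes "u \<in> C1_01" and "x \<in> {0..1}"
  shows "(u has_real_derivative D01 u x) (at x within {0..1})"
proof -
  have "u differentiable (at x within {0..1})"
    using assms by (auto simp: C1_01_def differentiable_on_def)
  then show ?thesis
    unfolding D01_def has_real_derivative_iff_has_vector_derivative
    by (rule vector_derivative_works[THEN iffD1])
qed

text \<open>
  Multiplying the equation by \<open>\<kappa> u' (1 + \<kappa> u'\<^sup>2) powr (-3/2)\<close> makes both sides exact derivatives.
  The equation is given only in the open interval; continuity carries the conservation law to the
  endpoints, where it is needed to show \<open>u' 0 \<noteq> 0\<close> and to keep zeros from accumulating there.
\<close>

lemma solution_energy_conserved:
  assumes sol: "is_solution \<kappa> l u" and "x \<in> {0..1}" and "y \<in> {0..1}"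
  shows "(1 + \<kappa> * (D01 u x)\<^sup>2) powr (-1/2) - \<kappa> * l * (u x)\<^sup>2 / 2
       = (1 + \<kappa> * (D01 u y)\<^sup>2) powr (-1/2) - \<kappa> * l * (u y)\<^sup>2 / 2"
proof -
  define q where "q = (\<lambda>x. 1 + \<kappa> * (D01 u x)\<^sup>2)"
  define E where "E = (\<lambda>x. q x powr (-1/2) - \<kappa> * l * (u x)\<^sup>2 / 2)"
  have u: "u \<in> C1_01" and v: "D01 u \<in> C1_01" and q_pos: "\<And>x. x \<in> {0..1} \<Longrightarrow> q x > 0"
    using sol by (auto simp: is_solution_def C2_01_def q_def)
  have cont_u: "continuous_on {0..1} u"
    using u by (simp add: C1_01_def differentiable_imp_continuous_on)
  have cont_q: "continuous_on {0..1} q"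
    unfolding q_def using u by (intro continuous_intros) (simp add: C1_01_def)
  have cont_E: "continuous_on {0..1} E"
    unfolding E_def using q_pos by (intro continuous_intros cont_u cont_q) force+
  have "(E has_real_derivative 0) (at x)" if x: "0 < x" "x < 1" for x
  proof -
    have at: "at x within {0..1} = at x"
      using x by (rule at_within_Icc_at)
    have du: "(u has_real_derivative D01 u x) (at x)"
      and dv: "(D01 u has_real_derivative D01 (D01 u) x) (at x)"
      using C1_01_has_derivative[OF u, of x] C1_01_has_derivative[OF v, of x] x by (auto simp: at)
    have ode: "D01 (D01 u) x = - (l * u x * q x powr (3/2))"
      using sol x by (auto simp: is_solution_def q_def)
    have "q x > 0" using q_pos x by simp
    then have cancel: "q x powr (-1/2 - 1) * q x powr (3/2) = 1"
      by (simp flip: powr_add)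
    have dq: "(q has_real_derivative \<kappa> * (2 * D01 u x * D01 (D01 u) x)) (at x)"
      unfolding q_def by (auto intro!: derivative_eq_intros dv)
    have "(E has_real_derivative
        (-1/2) * q x powr (-1/2 - 1) * (\<kappa> * (2 * D01 u x * D01 (D01 u) x))
        - \<kappa> * l * (2 * u x * D01 u x) / 2) (at x)"
      unfolding E_def using DERIV_fun_powr[OF dq \<open>q x > 0\<close>, of "-1/2"]
      by (intro DERIV_diff) (auto intro!: derivative_eq_intros du simp del: divide_minus_left)
    also have "(-1/2) * q x powr (-1/2 - 1) * (\<kappa> * (2 * D01 u x * D01 (D01 u) x))
        - \<kappa> * l * (2 * u x * D01 u x) / 2
        = \<kappa> * l * u x * D01 u x * (q x powr (-1/2 - 1) * q x powr (3/2) - 1)"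
      unfolding ode by algebra
    finally show ?thesis by (simp only: cancel) simp
  qed
  then have "E z = E 0" if "z \<in> {0..1}" for z
    using DERIV_isconst2[of 0 1 E z] cont_E that by auto
  then have "E x = E y" using assms(2,3) by metis
  then show ?thesis by (simp only: E_def q_def)
qed

text \<open>
  A double zero fixes the conserved quantity at \<open>1\<close>. For either sign of \<open>\<kappa>\<close>, monotonicity
  of \<open>powr\<close> in the exponent, comparing \<open>-1/2\<close> with \<open>0\<close>, then forces \<open>u\<^sup>2 \<le> 0\<close>.
\<close>

lemma zeros_simple_if_nontrivial:
  assumes sol: "is_solution \<kappa> l u" and "l > 0" and "\<kappa> \<noteq> 0" and "nontrivial u"
    and t: "t \<in> {0..1}" "u t = 0"
  shows "D01 u t \<noteq> 0"
proof
  assume "D01 u t = 0"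
  have "u x = 0" if x: "x \<in> {0..1}" for x
  proof -
    define q where "q = 1 + \<kappa> * (D01 u x)\<^sup>2"
    have "q > 0" using sol x by (auto simp: is_solution_def q_def)
    have eq: "q powr (-1/2) - 1 = \<kappa> * (l * (u x)\<^sup>2 / 2)"
      using solution_energy_conserved[OF sol x t(1)] t \<open>D01 u t = 0\<close> by (simp add: q_def)
    have "l * (u x)\<^sup>2 / 2 \<le> 0"
    proof (cases "\<kappa> > 0")
      case True
      then have "q \<ge> 1" by (simp add: q_def)
      then have "q powr (-1/2) \<le> q powr 0" by (intro powr_mono) auto
      then have "\<kappa> * (l * (u x)\<^sup>2 / 2) \<le> 0" using eq \<open>q > 0\<close> by simp
      then show ?thesis using True by (simp only: mult_le_0_iff) auto
    next
      case False
      then have "\<kappa> < 0" using \<open>\<kappa> \<noteq> 0\<close> by simp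
      then have "q \<le> 1" by (simp add: q_def mult_nonpos_nonneg)
      then have "q powr 0 \<le> q powr (-1/2)" using \<open>q > 0\<close> by (intro powr_mono') auto
      then have "0 \<le> \<kappa> * (l * (u x)\<^sup>2 / 2)" using eq \<open>q > 0\<close> by simp
      then show ?thesis using \<open>\<kappa> < 0\<close> by (simp only: zero_le_mult_iff) auto
    qed
    then show ?thesis using \<open>l > 0\<close> by (simp add: mult_le_0_iff)
  qed
  then show False using \<open>nontrivial u\<close> by (auto simp: nontrivial_def)
qed

lemma simple_zero_isolated:
  fixes f :: "real \<Rightarrow> real"
  assumes "(f has_real_derivative D) (at t within A)" and "D \<noteq> 0" and "f t = 0"
  shows "\<forall>\<^sub>F x in at t within A. f x \<noteq> 0"
proof -
  have "((\<lambda>x. (f x - f t) / (x - t)) \<longlongrightarrow> D) (at t within A)"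
    using assms(1) by (simp add: has_field_derivative_iff)
  then have "\<forall>\<^sub>F x in at t within A. (f x - f t) / (x - t) \<noteq> 0"
    using \<open>D \<noteq> 0\<close> by (rule tendsto_imp_eventually_ne)
  then show ?thesis
    by eventually_elim (use \<open>f t = 0\<close> in auto)
qed

text \<open>
  Infinitely many zeros would accumulate at a point of \<open>K\<close>, itself a zero by continuity,
  contradicting the isolation of simple zeros. Derivatives are taken within \<open>K\<close> so that the
  endpoints of an interval are covered by one-sided derivatives.
\<close>

lemma finite_zeros_if_simple:
  fixes f f' :: "real \<Rightarrow> real"
  assumes "compact K"
    and deriv: "\<And>x. x \<in> K \<Longrightarrow> (f has_real_derivative f' x) (at x within K)"
    and simple: "\<And>x. x \<in> K \<Longrightarrow> f x = 0 \<Longrightarrow> f' x \<noteq> 0"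
  shows "finite {x \<in> K. f x = 0}" (is "finite ?Z")
proof (rule ccontr)
  assume "infinite ?Z"
  then obtain t where t: "t \<in> K" "t islimpt ?Z"
    using \<open>compact K\<close>[unfolded compact_eq_Bolzano_Weierstrass, rule_format, of ?Z] by auto
  have "continuous_on K f"
    using deriv by (rule DERIV_continuous_on)
  then have "closed ?Z"
    using \<open>compact K\<close> continuous_closed_preimage_constant[of K f 0] by (simp add: compact_imp_closed)
  then have "t \<in> ?Z"
    using t(2) unfolding closed_limpt by (elim allE impE)
  then have "f t = 0" by simp
  have "\<forall>\<^sub>F x in at t within K. f x \<noteq> 0"
    using t \<open>f t = 0\<close> by (intro simple_zero_isolated[OF deriv simple]) auto
  then have "\<forall>\<^sub>F x in at t. x \<notin> ?Z"
    unfolding eventually_at_filter by eventually_elim auto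
  then show False
    using t by (simp add: islimpt_iff_eventually)
qed

theorem lemma2p1:
  fixes \<kappa> :: real and u :: "real \<Rightarrow> real"
  assumes "\<kappa> \<noteq> 0"
    and "\<exists>l>0. is_solution \<kappa> l u"
    and "nontrivial u"
  shows "\<exists>\<nu>\<in>{1, -1}. \<exists>n\<ge>1. u \<in> S n \<nu>"
proof -
  obtain l where "l > 0" and sol: "is_solution \<kappa> l u"
    using assms(2) by blast
  have simple: "D01 u t \<noteq> 0" if "t \<in> {0..1}" "u t = 0" for t
    using zeros_simple_if_nontrivial[OF sol \<open>l > 0\<close> assms(1,3) that] .
  have u: "u \<in> C1_01" and u0: "u 0 = 0" and u1: "u 1 = 0"
    using sol by (auto simp: is_solution_def C2_01_def)
  note deriv = C1_01_has_derivative[OF u]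
  have "finite {x \<in> {0..1}. u x = 0}"
    using deriv simple by (intro finite_zeros_if_simple[where f' = "D01 u"]) auto
  then have fin: "finite (interior_zeros u)"
    by (rule rev_finite_subset) (auto simp: interior_zeros_def)
  define \<nu> where "\<nu> = sgn (D01 u 0)"
  have "D01 u 0 \<noteq> 0" using simple u0 by simp
  then have \<nu>: "\<nu> \<in> {1, -1}" and "0 < \<nu> * D01 u 0"
    by (auto simp: \<nu>_def sgn_if)
  have "((\<lambda>x. \<nu> * u x) has_real_derivative \<nu> * D01 u 0) (at 0 within {0..1})"
    using deriv[of 0] by (intro DERIV_cmult) auto
  from has_real_derivative_pos_inc_right[OF this \<open>0 < \<nu> * D01 u 0\<close>]
  obtain d where "d > 0" and d: "\<And>h. h > 0 \<Longrightarrow> h \<in> {0..1} \<Longrightarrow> h < d \<Longrightarrow> 0 < \<nu> * u h"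
    using u0 by auto
  have "\<exists>\<epsilon>. 0 < \<epsilon> \<and> \<epsilon> \<le> 1 \<and> (\<forall>x. 0 < x \<and> x < \<epsilon> \<longrightarrow> 0 < \<nu> * u x)"
    using \<open>d > 0\<close> d by (intro exI[of _ "min d 1"]) auto
  moreover have "\<forall>t\<in>interior_zeros u. D01 u t \<noteq> 0"
    using simple by (auto simp: interior_zeros_def)
  ultimately have "u \<in> S (card (interior_zeros u) + 1) \<nu>"
    using u u0 u1 fin by (simp add: S_def C10_01_def)
  then show ?thesis using \<nu> by (metis le_add2)
qed

end
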